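(* Let $(a_1,\dots,a_{24})$ be the vector \[ (1,-4\beta^{2},-5\beta^{4},0,\beta^{8},2\beta^{10},\beta^{12},0,-5\beta^{16},-4\beta^{18},\beta^{20},0,\beta^{24},-4\beta^{26},-5\beta^{28},0,\beta^{32},2\beta^{34},\beta^{36},0,-5\beta^{40},-4\beta^{42},\beta^{44},0). \] Then \[ \sum_{k=0}^\infty\frac{1}{\alpha^{48k}}\sum_{j=1}^{24}\frac{a_j}{24k+j}=0. \]
   Context: $\alpha=(1+\sqrt5)/2$ is the golden ratio and $\beta=-1/\alpha=(1-\sqrt5)/2$. *)

theory Defs
  imports Complex_Main
begin

definition golden_alpha :: real where
  "golden_alpha = (1 + sqrt 5) / 2"

definition golden_beta :: real where
  "golden_beta = (1 - sqrt 5) / 2"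

lemma golden_beta_eq: "golden_beta = - 1 / golden_alpha"
proof -
  have "1 + sqrt 5 > (0::real)" by (simp add: add_pos_pos)
  then show ?thesis
    by (simp add: golden_alpha_def golden_beta_def field_simps)
qed

definition coeffs24 :: "real list" where
  "coeffs24 =
    (let \<beta> = golden_beta in
     [1, - 4 * \<beta> ^ 2, - 5 * \<beta> ^ 4, 0,
      \<beta> ^ 8, 2 * \<beta> ^ 10, \<beta> ^ 12, 0,
      - 5 * \<beta> ^ 16, - 4 * \<beta> ^ 18, \<beta> ^ 20, 0,
      \<beta> ^ 24, - 4 * \<beta> ^ 26, - 5 * \<beta> ^ 28, 0,
      \<beta> ^ 32, 2 * \<beta> ^ 34, \<beta> ^ 36, 0,
      - 5 * \<beta> ^ 40, - 4 * \<beta> ^ 42, \<beta> ^ 44, 0])"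

text \<open>The vector is indexed from 1 while lists are indexed from 0. Only the
  indices 1, ..., 24 are meaningful.\<close>

definition avec :: "nat \<Rightarrow> real" where
  "avec j = coeffs24 ! (j - 1)"

end

theory Submission
  imports Defs "HOL-Analysis.Complex_Transcendental"
begin

text \<open>
  With \<open>x = \<beta>\<^sup>2\<close> the series is \<open>1/x\<close> times \<open>\<Sum> c\<^sub>n x\<^sup>n / n\<close>, where
  the coefficient \<open>c\<^sub>n\<close> depends only on \<open>gcd n 12\<close>. Moebius inversion over the divisors
  of 12 turns this into a linear combination of the numbers \<open>ln (1 - x\<^sup>d)\<close>. Every
  \<open>1 - x\<^sup>d\<close> with \<open>d\<close> dividing 12 is a product of powers of \<open>-\<beta>\<close>, \<open>sqrt 5\<close>, 2 and 3 (it is a power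
  of \<open>-\<beta>\<close> times a Lucas number or times \<open>sqrt 5\<close> and a Fibonacci number), and all
  exponents cancel.
\<close>

text \<open>The logarithm series may be indexed from 0: division by zero gives 0, so the term at
  \<open>n = 0\<close> vanishes.\<close>

lemma ln_one_minus_sums:
  fixes x :: real
  assumes "\<bar>x\<bar> < 1"
  shows "(\<lambda>n. x ^ n / real n) sums - ln (1 - x)"
  using sums_minus[OF ln_series'[of "- x"]] assms by simp

text \<open>This is the series of \<open>- ln (1 - x ^ d)\<close> in powers of \<open>x ^ d\<close>,
  spread over the multiples of \<open>d\<close>; the weight \<open>d\<close> arises from 1/m =
  d/(d*m).\<close>

lemma ln_one_minus_power_sums:
  fixes x :: real
  assumes "\<bar>x\<bar> < 1" "0 < d"
  shows "(\<lambda>n. (if d dvd n then real d else 0) * x ^ n / real n) sums - ln (1 - x ^ d)"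
proof -
  have "\<bar>x ^ d\<bar> < 1"
    using assms by (simp add: power_abs power_less_one_iff)
  then have "(\<lambda>n. (x ^ d) ^ n / real n) sums - ln (1 - x ^ d)"
    by (rule ln_one_minus_sums)
  moreover have "(\<lambda>n. (x ^ d) ^ n / real n) =
      (\<lambda>n. (if d dvd d * n then real d else 0) * x ^ (d * n) / real (d * n))"
    using assms by (simp add: power_mult)
  moreover have "strict_mono (\<lambda>n. d * n)"
    using assms by (simp add: strict_mono_def)
  moreover have "(if d dvd n then real d else 0) * x ^ n / real n = 0"
    if "n \<notin> range (\<lambda>n. d * n)" for n
    using that by (auto elim: dvdE)
  ultimately show ?thesis
    using sums_mono_reindex[of "\<lambda>n. d * n"
      "\<lambda>n. (if d dvd n then real d else 0) * x ^ n / real n"]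
    by simp
qed

lemma golden_beta_square: "golden_beta ^ 2 = golden_beta + 1"
  by (simp add: golden_beta_def power2_eq_square field_simps)

lemma golden_beta_bounds: "-1 < golden_beta" "golden_beta < 0"
proof -
  have "sqrt 5 < sqrt 9" by (rule real_sqrt_less_mono) simp
  then show "-1 < golden_beta" by (simp add: golden_beta_def)
  have "sqrt 1 < sqrt 5" by (rule real_sqrt_less_mono) simp
  then show "golden_beta < 0" by (simp add: golden_beta_def)
qed

text \<open>Since y = 1/alpha and x = y^2, 1 - x^d = y^d * (alpha^d - y^d). The bracket is the Lucas
  number L_d for odd d and sqrt 5 * F_d for even d; here L_1 = 1, L_3 = 4, F_2 = 1, F_4 = 3, F_6 =
  8, F_12 = 144.\<close>

lemma ln_one_minus_golden_powers:
  defines "y \<equiv> - golden_beta" and "x \<equiv> golden_beta ^ 2"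
  shows "ln (1 - x) = ln y"
    and "ln (1 - x ^ 2) = 2 * ln y + ln (sqrt 5)"
    and "ln (1 - x ^ 3) = 3 * ln y + 2 * ln 2"
    and "ln (1 - x ^ 4) = 4 * ln y + ln 3 + ln (sqrt 5)"
    and "ln (1 - x ^ 6) = 6 * ln y + 3 * ln 2 + ln (sqrt 5)"
    and "ln (1 - x ^ 12) = 12 * ln y + 4 * ln 2 + 2 * ln 3 + ln (sqrt 5)"
proof -
  define r where "r = sqrt 5"
  have y: "0 < y" using golden_beta_bounds by (simp add: y_def)
  have r: "0 < r" and r_eq: "r = 2 * y + 1"
    by (simp_all add: r_def y_def golden_beta_def field_simps)
  have x_eq: "x = 1 - y"
    by (simp add: x_def y_def golden_beta_square)
  have y2: "y ^ 2 = 1 - y"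
    using x_eq by (simp add: x_def y_def)
  \<comment> \<open>Reduction modulo y^2 = 1 - y gives y^n = (-1)^n * (F_(n-1) - F_n * y), hence the
    Fibonacci coefficients.\<close>
  have y3: "y ^ 3 = 2 * y - 1"
    and y4: "y ^ 4 = 2 - 3 * y"
    and y6: "y ^ 6 = 5 - 8 * y"
    and y12: "y ^ 12 = 89 - 144 * y"
    using y2 by algebra+
  have x2: "x ^ 2 = 2 - 3 * y"
    and x3: "x ^ 3 = 5 - 8 * y"
    and x4: "x ^ 4 = 13 - 21 * y"
    and x6: "x ^ 6 = 89 - 144 * y"
    and x12: "x ^ 12 = 28657 - 46368 * y"
    using y2 x_eq by algebra+
  have "1 - x = y" using x_eq by simp
  then show "ln (1 - x) = ln y" by simp
  have "1 - x ^ 2 = y ^ 2 * r"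
    unfolding x2 y2 r_eq using y2 by algebra
  then show "ln (1 - x ^ 2) = 2 * ln y + ln (sqrt 5)"
    using y r by (simp add: ln_mult ln_realpow r_def)
  have "1 - x ^ 3 = y ^ 3 * 2 ^ 2"
    unfolding x3 y3 by simp
  then show "ln (1 - x ^ 3) = 3 * ln y + 2 * ln 2"
    using y by (simp only: ln_mult_pos ln_realpow zero_less_power zero_less_numeral of_nat_numeral)
  have "1 - x ^ 4 = y ^ 4 * 3 * r"
    unfolding x4 y4 r_eq using y2 by algebra
  then show "ln (1 - x ^ 4) = 4 * ln y + ln 3 + ln (sqrt 5)"
    using y r by (simp add: ln_mult ln_realpow r_def)
  have "1 - x ^ 6 = y ^ 6 * 2 ^ 3 * r"
    unfolding x6 y6 r_eq using y2 by algebra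
  then show "ln (1 - x ^ 6) = 6 * ln y + 3 * ln 2 + ln (sqrt 5)"
    using y r by (simp only: ln_mult_pos ln_realpow zero_less_power zero_less_numeral
        of_nat_numeral mult_pos_pos r_def)
  have "1 - x ^ 12 = y ^ 12 * 2 ^ 4 * 3 ^ 2 * r"
    unfolding x12 y12 r_eq using y2 by algebra
  then show "ln (1 - x ^ 12) = 12 * ln y + 4 * ln 2 + 2 * ln 3 + ln (sqrt 5)"
    using y r by (simp only: ln_mult_pos ln_realpow zero_less_power zero_less_numeral
        of_nat_numeral mult_pos_pos r_def)
qed

text \<open>The weight of the divisor \<open>d\<close> is \<open>d\<close> times the exponent of \<open>1 / (1 - x\<^sup>d)\<close>
  in the product whose logarithm is summed.\<close>

definition divisor_coeff :: "nat \<Rightarrow> real" where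
  "divisor_coeff n =
     (if 1 dvd n then real 1 else 0) - 5 / 2 * (if 2 dvd n then real 2 else 0)
     - 2 * (if 3 dvd n then real 3 else 0) + (if 4 dvd n then real 4 else 0)
     + 2 * (if 6 dvd n then real 6 else 0) - 1 / 2 * (if 12 dvd n then real 12 else 0)"

lemma divisor_coeff_add_24: "divisor_coeff (24 * k + j) = divisor_coeff j"
proof -
  have "d dvd 24 * k + j \<longleftrightarrow> d dvd j" if "d dvd 24" for d
    using that by (simp add: dvd_add_right_iff)
  then show ?thesis by (simp add: divisor_coeff_def)
qed

lemma avec_eq:
  assumes "j \<in> {1..24}"
  shows "avec j = divisor_coeff j * (golden_beta ^ 2) ^ (j - 1)"
proof -
  have "j \<in> {1,2,3,4,5,6,7,8,9,10,11,12,13,14,15,16,17,18,19,20,21,22,23,24}"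
    using assms by (simp only: atLeastAtMost_iff insert_iff empty_iff) presburger
  then show ?thesis
    by (elim insertE emptyE)
       (simp_all add: avec_def coeffs24_def Let_def divisor_coeff_def flip: power_mult)
qed

lemma divisor_coeff_sums:
  defines "x \<equiv> golden_beta ^ 2"
  shows "(\<lambda>n. divisor_coeff n * x ^ n / real n) sums 0"
proof -
  have x: "\<bar>x\<bar> < 1"
    using golden_beta_bounds by (simp add: x_def golden_beta_square)
  have "(\<lambda>n. (if 1 dvd n then real 1 else 0) * x ^ n / real n
      - 5 / 2 * ((if 2 dvd n then real 2 else 0) * x ^ n / real n)
      - 2 * ((if 3 dvd n then real 3 else 0) * x ^ n / real n)
      + (if 4 dvd n then real 4 else 0) * x ^ n / real n
      + 2 * ((if 6 dvd n then real 6 else 0) * x ^ n / real n)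
      - 1 / 2 * ((if 12 dvd n then real 12 else 0) * x ^ n / real n))
    sums (- ln (1 - x ^ 1) - 5 / 2 * - ln (1 - x ^ 2) - 2 * - ln (1 - x ^ 3)
      + - ln (1 - x ^ 4) + 2 * - ln (1 - x ^ 6) - 1 / 2 * - ln (1 - x ^ 12))"
    by (intro sums_add sums_diff sums_mult ln_one_minus_power_sums x) simp_all
  \<comment> \<open>The coefficients cancel separately: -1 + 5 + 6 - 4 - 12 + 6 for
    \<open>ln y\<close> with y = -beta, 4 - 6 + 2 for \<open>ln 2\<close>, -1 + 1 for
    \<open>ln 3\<close>, and 5/2 - 1 - 2 + 1/2 for \<open>ln (sqrt 5)\<close>.\<close>
  also have "(- ln (1 - x ^ 1) - 5 / 2 * - ln (1 - x ^ 2) - 2 * - ln (1 - x ^ 3)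
      + - ln (1 - x ^ 4) + 2 * - ln (1 - x ^ 6) - 1 / 2 * - ln (1 - x ^ 12)) = 0"
    unfolding x_def power_one_right ln_one_minus_golden_powers by (simp add: field_simps)
  finally show ?thesis
    by (rule back_subst[where P = "\<lambda>f. f sums 0"])
       (simp add: divisor_coeff_def fun_eq_iff add_divide_distrib diff_divide_distrib
          ring_distribs)
qed

theorem theorem4p3:
  shows "(\<lambda>k::nat. 1 / golden_alpha ^ (48 * k) *
           (\<Sum>j::nat = 1..24. avec j / real (24 * k + j))) sums 0"
proof -
  define x where "x = golden_beta ^ 2"
  define f where "f = (\<lambda>n. divisor_coeff n * x ^ n / real n)"
  have x: "0 < x" using golden_beta_bounds by (simp add: x_def)
  have alpha: "1 / golden_alpha ^ (48 * k) = x ^ (24 * k)" for k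
    by (simp add: x_def golden_beta_eq power_divide flip: power_mult)
  have "f sums 0"
    using divisor_coeff_sums by (simp add: f_def x_def)
  \<comment> \<open>Dropping the zero term at index 0 aligns the blocks of 24 with the indices
    24k+1, ..., 24k+24.\<close>
  moreover have "f 0 = 0"
    by (simp add: f_def)
  ultimately have "(\<lambda>n. f (Suc n)) sums 0"
    by (simp add: sums_Suc_iff)
  then have "(\<lambda>k. \<Sum>n = k * 24..<k * 24 + 24. f (Suc n)) sums 0"
    by (rule sums_group) simp
  \<comment> \<open>The factor 1/x is needed because \<open>avec j\<close> carries
    \<open>x ^ (j - 1)\<close>, while \<open>f\<close> carries \<open>x ^ j\<close>.\<close>
  then have "(\<lambda>k. 1 / x * (\<Sum>n = k * 24..<k * 24 + 24. f (Suc n))) sums (1 / x * 0)"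
    by (rule sums_mult)
  moreover have "1 / x * (\<Sum>n = k * 24..<k * 24 + 24. f (Suc n)) =
      1 / golden_alpha ^ (48 * k) * (\<Sum>j = 1..24. avec j / real (24 * k + j))" for k
  proof -
    have "(\<Sum>n = k * 24..<k * 24 + 24. f (Suc n)) = (\<Sum>j = 1..24. f (24 * k + j))"
      by (rule sum.reindex_bij_witness[of _ "\<lambda>j. 24 * k + j - 1" "\<lambda>n. Suc n - 24 * k"]) auto
    also have "\<dots> = (\<Sum>j = 1..24. x * (x ^ (24 * k) * (avec j / real (24 * k + j))))"
    proof (rule sum.cong)
      fix j :: nat assume j: "j \<in> {1..24}"
      then have "x ^ (24 * k + j) = x * (x ^ (24 * k) * x ^ (j - 1))"
        by (cases j) (simp_all add: power_add)
      then show "f (24 * k + j) = x * (x ^ (24 * k) * (avec j / real (24 * k + j)))"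
        by (simp add: f_def divisor_coeff_add_24 avec_eq[OF j] x_def)
    qed simp
    also have "\<dots> = x * (x ^ (24 * k) * (\<Sum>j = 1..24. avec j / real (24 * k + j)))"
      by (simp only: sum_distrib_left)
    finally show ?thesis
      using x by (simp only: alpha) simp
  qed
  ultimately show ?thesis by simp
qed

end
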